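(* Let $(P,\preceq)$ be a locally finite lattice and let $f:P\to\mathbb{C}$ be semimultiplicative with $f(x)\neq0$ for all $x\in P$. Let $S=\{x_1,\dots,x_n\}\subseteq P$ be upper-closed up to $\vee S$, indexed so that $x_i\preceq x_j\Rightarrow i\le j$. If $(S)_f$ is invertible, then its inverse is the $n\times n$ matrix $B=(b_{ij})$ with $$b_{ij}=\frac{1}{f(x_i)f(x_j)}\sum_{x_k\in S,\ x_k\preceq x_i\wedge x_j}\frac{\mu(x_k,x_i)\mu(x_k,x_j)}{\Psi_{S,1/f}(x_k)},$$ where $\mu$ is the Möbius function of $(P,\preceq)$.
   Context: $f$ is semimultiplicative if $f(x)f(y)=f(x\wedge y)f(x\vee y)$ for all $x,y\in P$. $\vee S=x_1\vee\cdots\vee x_n$; $S$ is upper-closed up to $\vee S$ if $x\in S$ whenever $y\in S$, $y\preceq x$ and $x\preceq\vee S$. $(S)_f$ is the $n\times n$ matrix with $(i,j)$ entry $f(x_i\wedge x_j)$. $\Psi_{S,1/f}$ is defined on $S$ recursively by $\Psi_{S,1/f}(x_k)=1/f(x_k)-\sum_{x_v\in S,\ x_k\prec x_v}\Psi_{S,1/f}(x_v)$. *)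

theory Defs
  imports Complex_Main "Jordan_Normal_Form.Matrix"
begin

class locally_finite_lattice = lattice +
  assumes finite_interval: "finite {x..y}"

function moebius :: "'a::locally_finite_lattice \<Rightarrow> 'a \<Rightarrow> int" where
  "moebius x y =
     (if x = y then 1
      else if x < y then - (\<Sum>z\<in>{x..<y}. moebius x z)
      else 0)"
  by pat_completeness auto
termination
proof (relation "measure (\<lambda>(x, y). card {x..y})")
  fix x y z :: 'a
  assume "z \<in> {x..<y}"
  then have "{x..z} \<subset> {x..y}"
    by auto
  then show "((x, z), (x, y)) \<in> measure (\<lambda>(x, y). card {x..y})"
    by (simp add: psubset_card_mono finite_interval)
qed simp

declare moebius.simps [simp del]

definition semimultiplicative :: "('a::lattice \<Rightarrow> 'b::times) \<Rightarrow> bool" where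
  "semimultiplicative f \<longleftrightarrow> (\<forall>x y. f x * f y = f (inf x y) * f (sup x y))"

definition upper_closed_up_to_join :: "'a::lattice set \<Rightarrow> bool" where
  "upper_closed_up_to_join S \<longleftrightarrow>
     (\<forall>x y. y \<in> S \<longrightarrow> y \<le> x \<longrightarrow> x \<le> Sup_fin S \<longrightarrow> x \<in> S)"

text \<open>The value for infinite \<open>S\<close> is a junk value: the recursion is only meant for finite \<open>S\<close>.\<close>

function Psi :: "'a::order set \<Rightarrow> ('a \<Rightarrow> 'b::ab_group_add) \<Rightarrow> 'a \<Rightarrow> 'b" where
  "Psi S g x = (if finite S then g x - (\<Sum>v\<in>{v \<in> S. x < v}. Psi S g v) else 0)"
  by pat_completeness auto
termination
proof (relation "measure (\<lambda>(S, g, x). card {v \<in> S. x < v})")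
  fix S :: "'a set" and g :: "'a \<Rightarrow> 'b" and x v :: 'a
  assume "finite S" and v: "v \<in> {v \<in> S. x < v}"
  moreover have "{w \<in> S. v < w} \<subset> {w \<in> S. x < w}"
    using v by auto
  ultimately show "((S, g, v), (S, g, x)) \<in> measure (\<lambda>(S, g, x). card {v \<in> S. x < v})"
    by (simp add: psubset_card_mono)
qed simp

declare Psi.simps [simp del]

text \<open>Elements and matrix entries are indexed by \<open>0, \<dots>, n - 1\<close>.\<close>

definition meet_matrix :: "nat \<Rightarrow> (nat \<Rightarrow> 'a::lattice) \<Rightarrow> ('a \<Rightarrow> 'b) \<Rightarrow> 'b mat" where
  "meet_matrix n x f = mat n n (\<lambda>(i, j). f (inf (x i) (x j)))"

end

theory Submission
  imports Defs "Jordan_Normal_Form.Determinant"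
begin

text \<open>
  Semimultiplicativity gives \<open>f (x \<sqinter> y) = f x \<cdot> f y / f (x \<squnion> y)\<close>, and \<open>x \<squnion> y\<close> stays in \<open>S\<close> because
  \<open>S\<close> is upper-closed up to its join. Expanding \<open>1 / f (x \<squnion> y)\<close> as the sum of \<open>\<Psi>\<close> over the upper
  bounds of \<open>x\<close> and \<open>y\<close> in \<open>S\<close> factors the meet matrix as \<open>G \<Lambda> G\<^sup>T\<close>, where \<open>\<Lambda>\<close> is the diagonal
  matrix of the values of \<open>\<Psi>\<close> and \<open>G\<close> is the zeta matrix with rows scaled by \<open>f\<close>. Since \<open>S\<close> contains
  every interval between two of its elements, the Moebius function of the whole lattice inverts
  \<open>G\<close>, and invertibility of the product forces \<open>\<Lambda>\<close> to be invertible.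
\<close>

lemma moebius_not_le: "\<not> x \<le> y \<Longrightarrow> moebius x y = 0"
  by (subst moebius.simps) auto

text \<open>For \<open>x < y\<close> this is the recursion for \<open>moebius x y\<close> with all
  terms moved to one side; otherwise the interval is a singleton or empty.\<close>

lemma sum_moebius_interval:
  fixes x y :: "'a::locally_finite_lattice"
  shows "(\<Sum>z\<in>{x..y}. moebius x z) = (if x = y then 1 else 0)"
proof (cases "x < y")
  case True
  then have "{x..y} = insert y {x..<y}"
    by (auto simp: order.order_iff_strict)
  moreover have "finite {x..<y}"
    by (rule finite_subset[OF _ finite_interval[of x y]]) auto
  ultimately have "(\<Sum>z\<in>{x..y}. moebius x z) = moebius x y + (\<Sum>z\<in>{x..<y}. moebius x z)"
    by simp
  also have "moebius x y = - (\<Sum>z\<in>{x..<y}. moebius x z)"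
    using True by (subst moebius.simps) auto
  finally show ?thesis
    using True by auto
next
  case False
  then show ?thesis
    by (cases "x = y") (auto simp: moebius.simps[of y y] order.order_iff_strict)
qed

text \<open>The recursion for \<open>Psi\<close>, solved for \<open>g x\<close>: on
  \<open>S\<close>, \<open>Psi\<close> is the Moebius inversion of \<open>g\<close> from above. As
  \<open>x\<close> lies in \<open>S\<close>, it contributes the term
  \<open>Psi S g x\<close>.\<close>

lemma sum_Psi_upper:
  assumes "finite S" and "x \<in> S"
  shows "(\<Sum>v\<in>{v \<in> S. x \<le> v}. Psi S g v) = g x"
proof -
  have "{v \<in> S. x \<le> v} = insert x {v \<in> S. x < v}"
    using assms(2) by (auto simp: order.order_iff_strict)
  then have "(\<Sum>v\<in>{v \<in> S. x \<le> v}. Psi S g v) = Psi S g x + (\<Sum>v\<in>{v \<in> S. x < v}. Psi S g v)"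
    using assms(1) by simp
  then show ?thesis
    using assms(1) by (simp add: Psi.simps[of S g x])
qed

lemma upper_closed_up_to_join_sup:
  assumes "upper_closed_up_to_join S" and "finite S" and "x \<in> S" and "y \<in> S"
  shows "sup x y \<in> S"
proof -
  have "sup x y \<le> Sup_fin S"
    using assms by (simp add: Sup_fin.coboundedI)
  then show ?thesis
    using assms(1,3) unfolding upper_closed_up_to_join_def by (meson sup_ge1)
qed

text \<open>Lets Moebius sums over an interval of the lattice be taken inside
  \<open>S\<close>.\<close>

lemma upper_closed_up_to_join_interval:
  assumes "upper_closed_up_to_join S" and "finite S" and "x \<in> S" and "y \<in> S"
  shows "{x..y} \<subseteq> S"
  using assms unfolding upper_closed_up_to_join_def
  by (meson Sup_fin.coboundedI atLeastAtMost_iff order_trans subsetI)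

text \<open>With \<open>K\<close> the inverse of \<open>G\<close>, inverting the factors of
  \<open>A\<close> in reverse order gives \<open>B\<close>, once every \<open>d k\<close> is known
  to be nonzero. This comes from the inverse of \<open>A\<close>, which yields a right inverse of
  the diagonal factor.\<close>

lemma inverse_of_diagonal_congruence:
  fixes G K :: "'a::field mat" and d :: "nat \<Rightarrow> 'a"
  assumes G: "G \<in> carrier_mat n n" and K: "K \<in> carrier_mat n n"
    and KG: "K * G = 1\<^sub>m n"
    and A: "A = G * (mat_diag n d * G\<^sup>T)"
    and inv: "invertible_mat A"
    and B: "B = K\<^sup>T * (mat_diag n (\<lambda>k. 1 / d k) * K)"
  shows "A * B = 1\<^sub>m n \<and> B * A = 1\<^sub>m n"
proof -
  have GK: "G * K = 1\<^sub>m n"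
    using mat_mult_left_right_inverse[OF K G KG] .
  have KG_T: "G\<^sup>T * K\<^sup>T = 1\<^sub>m n"
    using KG transpose_mult[OF K G] by simp
  have [simp]: "G \<in> carrier_mat n n" "K \<in> carrier_mat n n"
    "G\<^sup>T \<in> carrier_mat n n" "K\<^sup>T \<in> carrier_mat n n"
    "\<And>e. mat_diag n e \<in> carrier_mat n n"
    using G K by auto
  have A_car[simp]: "A \<in> carrier_mat n n" and [simp]: "B \<in> carrier_mat n n"
    unfolding A B by (simp_all add: mult_carrier_mat[of _ n n _ n])
  have dim_A: "dim_row A = n" "dim_col A = n"
    using carrier_matD[OF A_car] .
  from inv obtain C where C: "A * C = 1\<^sub>m n" "C * A = 1\<^sub>m (dim_row C)"
    unfolding invertible_mat_def inverts_mat_def dim_A by auto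
  \<comment> \<open>Comparing column counts in the two equations for \<open>C\<close> fixes both of
    its dimensions.\<close>
  have [simp]: "C \<in> carrier_mat n n"
  proof (rule carrier_matI)
    have "dim_col (C * A) = dim_col A" by simp
    then show "dim_row C = n" using C(2) dim_A by simp
    have "dim_col (A * C) = dim_col C" by simp
    then show "dim_col C = n" using C(1) by simp
  qed
  have KA: "K * A = mat_diag n d * G\<^sup>T"
    unfolding A by (subst assoc_mult_mat[symmetric, of _ n n _ n _ n])
      (simp_all add: KG mult_carrier_mat[of _ n n _ n] left_mult_one_mat[of _ n n])
  \<comment> \<open>Since \<open>K * A\<close> is the diagonal matrix times
    \<open>G\<^sup>T\<close>, the product collapses to
    \<open>K * (A * C) * G = K * G\<close>.\<close>
  have diag_inv: "mat_diag n d * (G\<^sup>T * (C * G)) = 1\<^sub>m n"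
  proof -
    have "mat_diag n d * (G\<^sup>T * (C * G)) = (mat_diag n d * G\<^sup>T) * (C * G)"
      by (rule assoc_mult_mat[symmetric, of _ n n _ n _ n]) (simp_all add: mult_carrier_mat[of _ n n _ n])
    also have "\<dots> = K * (A * (C * G))"
      unfolding KA[symmetric]
      by (rule assoc_mult_mat[of _ n n _ n _ n]) (simp_all add: mult_carrier_mat[of _ n n _ n])
    also have "A * (C * G) = (A * C) * G"
      by (rule assoc_mult_mat[symmetric, of _ n n _ n _ n]) auto
    finally show ?thesis
      using C(1) KG G by simp
  qed
  \<comment> \<open>If \<open>d k\<close> were zero, row \<open>k\<close> of the product in
    \<open>diag_inv\<close> would vanish, against its diagonal entry 1.\<close>
  have d_nz: "d k \<noteq> 0" if "k < n" for k
  proof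
    assume "d k = 0"
    moreover have "(mat_diag n d * (G\<^sup>T * (C * G))) $$ (k, k) = d k * (G\<^sup>T * (C * G)) $$ (k, k)"
      using that by (subst mat_diag_mult_left[of _ n n]) (simp_all add: mult_carrier_mat[of _ n n _ n])
    ultimately show False
      using that by (simp add: diag_inv)
  qed
  have diag: "mat_diag n d * mat_diag n (\<lambda>k. 1 / d k) = 1\<^sub>m n"
    unfolding mat_diag_diag by (rule eq_matI) (auto simp: d_nz mat_diag_def)
  have "A * B = G * (mat_diag n d * (G\<^sup>T * B))"
    unfolding A
    by (simp add: assoc_mult_mat[of _ n n _ n _ n] mult_carrier_mat[of _ n n _ n])
  also have "G\<^sup>T * B = mat_diag n (\<lambda>k. 1 / d k) * K"
    unfolding B by (subst assoc_mult_mat[symmetric, of _ n n _ n _ n])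
      (simp_all add: KG_T mult_carrier_mat[of _ n n _ n] left_mult_one_mat[of _ n n])
  also have "mat_diag n d * (mat_diag n (\<lambda>k. 1 / d k) * K) = K"
    by (subst assoc_mult_mat[symmetric, of _ n n _ n _ n]) (simp_all add: diag left_mult_one_mat[of _ n n] del: mat_diag_diag)
  finally have AB: "A * B = 1\<^sub>m n"
    using GK by simp
  then show ?thesis
    using mat_mult_left_right_inverse[of A n B] by simp
qed

theorem theorem6p13:
  fixes f :: "'a::locally_finite_lattice \<Rightarrow> complex"
    and S :: "'a set" and n :: nat and x :: "nat \<Rightarrow> 'a"
  assumes "semimultiplicative f"
    and "\<And>p. f p \<noteq> 0"
    and "n \<ge> 1"
    and "bij_betw x {0..<n} S"
    and "upper_closed_up_to_join S"
    and "\<And>i j. i < n \<Longrightarrow> j < n \<Longrightarrow> x i \<le> x j \<Longrightarrow> i \<le> j"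
    and "invertible_mat (meet_matrix n x f)"
  defines "B \<equiv> mat n n (\<lambda>(i, j).
      1 / (f (x i) * f (x j)) *
      (\<Sum>y\<in>{y \<in> S. y \<le> inf (x i) (x j)}.
         of_int (moebius y (x i)) * of_int (moebius y (x j)) / Psi S (\<lambda>z. 1 / f z) y))"
  shows "inverts_mat (meet_matrix n x f) B \<and> inverts_mat B (meet_matrix n x f)"
proof -
  note nz = assms(2)
  have fin: "finite S"
    using assms(4) bij_betw_finite by blast
  have xS: "x i \<in> S" if "i < n" for i
    using bij_betwE[OF assms(4)] that by simp
  have reindex: "(\<Sum>k = 0..<n. h (x k)) = (\<Sum>y\<in>S. h y)" for h :: "'a \<Rightarrow> complex"
    using sum.reindex_bij_betw[OF assms(4)] .
  define \<psi> where "\<psi> = Psi S (\<lambda>z. 1 / f z)"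
  define G :: "complex mat" where
    "G = mat n n (\<lambda>(i, k). f (x i) * of_bool (x i \<le> x k))"
  \<comment> \<open>Column \<open>i\<close> is divided by \<open>f (x i)\<close> to cancel the
    scaling of row \<open>i\<close> of \<open>G\<close> in \<open>K * G\<close>.\<close>
  define K :: "complex mat" where
    "K = mat n n (\<lambda>(k, i). of_int (moebius (x k) (x i)) / f (x i))"
  have G: "G \<in> carrier_mat n n" and K: "K \<in> carrier_mat n n"
    by (simp_all add: G_def K_def)
  have KG: "K * G = 1\<^sub>m n"
  proof (rule eq_matI)
    fix i j assume ij: "i < dim_row (1\<^sub>m n :: complex mat)" "j < dim_col (1\<^sub>m n :: complex mat)"
    have "(K * G) $$ (i, j) =
        (\<Sum>k = 0..<n. of_int (moebius (x i) (x k)) * of_bool (x k \<le> x j))"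
      using ij nz by (auto simp: K_def G_def scalar_prod_def intro!: sum.cong)
    also have "\<dots> = (\<Sum>y\<in>S. of_int (moebius (x i) y) * of_bool (y \<le> x j))"
      by (rule reindex)
    \<comment> \<open>Outside the interval, either the Moebius value or the indicator is
      zero.\<close>
    also have "\<dots> = (\<Sum>y\<in>{x i..x j}. of_int (moebius (x i) y))"
      using upper_closed_up_to_join_interval[OF assms(5) fin xS xS] ij fin
      by (intro sum.mono_neutral_cong_right) (auto simp: moebius_not_le)
    also have "\<dots> = of_int (if x i = x j then 1 else 0)"
      by (simp only: of_int_sum[symmetric] sum_moebius_interval)
    also have "\<dots> = 1\<^sub>m n $$ (i, j)"
      using bij_betw_imp_inj_on[OF assms(4)] ij by (auto simp: inj_on_def)
    finally show "(K * G) $$ (i, j) = 1\<^sub>m n $$ (i, j)" .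
  qed (simp_all add: G_def K_def)
  have A: "meet_matrix n x f = G * (mat_diag n (\<lambda>k. \<psi> (x k)) * G\<^sup>T)"
  proof (rule eq_matI)
    fix i j
    assume "i < dim_row (G * (mat_diag n (\<lambda>k. \<psi> (x k)) * G\<^sup>T))"
      and "j < dim_col (G * (mat_diag n (\<lambda>k. \<psi> (x k)) * G\<^sup>T))"
    then have ij: "i < n" "j < n"
      by (simp_all add: G_def)
    \<comment> \<open>The indicators of \<open>x i \<le> x k\<close> and
      \<open>x j \<le> x k\<close> multiply to that of
      \<open>sup (x i) (x j) \<le> x k\<close>.\<close>
    have "(G * (mat_diag n (\<lambda>k. \<psi> (x k)) * G\<^sup>T)) $$ (i, j) =
        (\<Sum>k = 0..<n. f (x i) * f (x j) * (of_bool (sup (x i) (x j) \<le> x k) * \<psi> (x k)))"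
      using ij G
      by (subst mat_diag_mult_left[of _ n n])
        (auto simp: G_def scalar_prod_def intro!: sum.cong)
    also have "\<dots> = f (x i) * f (x j) * (\<Sum>y\<in>S. of_bool (sup (x i) (x j) \<le> y) * \<psi> y)"
      by (subst reindex[symmetric]) (simp only: sum_distrib_left)
    also have "(\<Sum>y\<in>S. of_bool (sup (x i) (x j) \<le> y) * \<psi> y) =
        (\<Sum>y\<in>{y \<in> S. sup (x i) (x j) \<le> y}. \<psi> y)"
      using fin by (intro sum.mono_neutral_cong_right) auto
    also have "\<dots> = 1 / f (sup (x i) (x j))"
      unfolding \<psi>_def
      by (rule sum_Psi_upper[OF fin upper_closed_up_to_join_sup[OF assms(5) fin xS xS]])
        (use ij in auto)
    also have "f (x i) * f (x j) * \<dots> = f (inf (x i) (x j))"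
      using assms(1) nz unfolding semimultiplicative_def by (simp add: divide_eq_eq)
    finally show "meet_matrix n x f $$ (i, j) =
        (G * (mat_diag n (\<lambda>k. \<psi> (x k)) * G\<^sup>T)) $$ (i, j)"
      using ij by (simp add: meet_matrix_def)
  qed (simp_all add: G_def meet_matrix_def)
  have B: "B = K\<^sup>T * (mat_diag n (\<lambda>k. 1 / \<psi> (x k)) * K)"
  proof (rule eq_matI)
    fix i j
    assume "i < dim_row (K\<^sup>T * (mat_diag n (\<lambda>k. 1 / \<psi> (x k)) * K))"
      and "j < dim_col (K\<^sup>T * (mat_diag n (\<lambda>k. 1 / \<psi> (x k)) * K))"
    then have ij: "i < n" "j < n"
      by (simp_all add: K_def)
    have "(K\<^sup>T * (mat_diag n (\<lambda>k. 1 / \<psi> (x k)) * K)) $$ (i, j) =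
        (\<Sum>k = 0..<n. 1 / (f (x i) * f (x j)) *
          (of_int (moebius (x k) (x i)) * of_int (moebius (x k) (x j)) / \<psi> (x k)))"
      using ij K
      by (subst mat_diag_mult_left[of _ n n])
        (auto simp: K_def scalar_prod_def intro!: sum.cong)
    also have "\<dots> = 1 / (f (x i) * f (x j)) *
        (\<Sum>y\<in>S. of_int (moebius y (x i)) * of_int (moebius y (x j)) / \<psi> y)"
      by (subst reindex[symmetric]) (simp only: sum_distrib_left)
    \<comment> \<open>If \<open>y\<close> is not below the meet, it fails to be below
      \<open>x i\<close> or \<open>x j\<close>, and the corresponding Moebius factor is
      zero.\<close>
    also have "(\<Sum>y\<in>S. of_int (moebius y (x i)) * of_int (moebius y (x j)) / \<psi> y) =
        (\<Sum>y\<in>{y \<in> S. y \<le> inf (x i) (x j)}.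
          of_int (moebius y (x i)) * of_int (moebius y (x j)) / \<psi> y)"
      using fin by (intro sum.mono_neutral_right) (auto intro: ccontr dest: moebius_not_le)
    finally show "B $$ (i, j) = (K\<^sup>T * (mat_diag n (\<lambda>k. 1 / \<psi> (x k)) * K)) $$ (i, j)"
      using ij by (simp add: B_def \<psi>_def)
  qed (simp_all add: K_def B_def)
  show ?thesis
    using inverse_of_diagonal_congruence[OF G K KG A assms(7) B]
    by (simp add: inverts_mat_def meet_matrix_def B_def)
qed

end
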